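(* Let $p=2$. There are constants $\alpha>0$ and $N_0$, independent of $N$, such that for every $N\ge N_0$ and every polynomial $g\in\mathbb{F}_2[x_1,\dots,x_N]$ of degree at most $3$, $$|\langle S_4,g\rangle|<\exp\{-\alpha N\},$$ where $S_4(x)=\sum_{T\subseteq[N],\,|T|=4}\prod_{i\in T}x_i$.
   Context: For $f,g:\mathbb{F}_2^N\to\mathbb{F}_2$, $\langle f,g\rangle=\mathbb{E}_{x\in\mathbb{F}_2^N}(-1)^{f(x)-g(x)}$. *)

theory Defs
  imports Complex_Main "HOL-Library.Z2"
begin

definition cube :: "nat \<Rightarrow> (nat \<Rightarrow> bit) set" where
  "cube N = {x. \<forall>i. N \<le> i \<longrightarrow> x i = 0}"

definition corr :: "nat \<Rightarrow> ((nat \<Rightarrow> bit) \<Rightarrow> bit) \<Rightarrow> ((nat \<Rightarrow> bit) \<Rightarrow> bit) \<Rightarrow> real" where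
  "corr N f g = (\<Sum>x\<in>cube N. (if f x - g x = 0 then 1 else -1)) / 2 ^ N"

definition S :: "nat \<Rightarrow> nat \<Rightarrow> (nat \<Rightarrow> bit) \<Rightarrow> bit" where
  "S N k x = (\<Sum>T\<in>{T. T \<subseteq> {..<N} \<and> card T = k}. \<Prod>i\<in>T. x i)"

text \<open>Polynomial functions in N variables of degree at most d, given by the coefficients
  c T of the monomials prod_{i in T} x_i (over F_2, x_i^2 = x_i).\<close>
definition poly_fun :: "nat \<Rightarrow> nat \<Rightarrow> (nat set \<Rightarrow> bit) \<Rightarrow> (nat \<Rightarrow> bit) \<Rightarrow> bit" where
  "poly_fun N d c x = (\<Sum>T\<in>{T. T \<subseteq> {..<N} \<and> card T \<le> d}. c T * (\<Prod>i\<in>T. x i))"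

end

theory Submission
  imports Defs "HOL-Library.Function_Algebras" "HOL-Analysis.Convex"
begin

text \<open>
  Since \<open>S\<^sub>4(x)\<close> is the parity of \<open>|x| choose 4\<close>, the sign of \<open>S\<^sub>4\<close> is a combination of
  \<open>\<zeta>^|x|\<close> with \<open>\<zeta>\<close> a primitive eighth root of unity. The phase
  \<open>\<zeta>^|x| (-1)^g(x)\<close> with \<open>g\<close> cubic is a non-classical cubic: its third multiplicative
  derivative does not depend on \<open>x\<close> and equals \<open>(-1)^\<tau>(a,b,c)\<close>, where \<open>\<tau>\<close> is a symmetric
  trilinear form over \<open>F\<^sub>2\<close>. The alternating part of \<open>\<tau>\<close> comes from \<open>g\<close>, and the weight
  contributes the diagonal form, so \<open>\<tau>(a,x,x) = <a,x>\<close>. Three applications of Cauchy--Schwarz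
  bound the eighth power of the bias of the phase by the bias \<open>\<mu>\<close> of \<open>\<tau>\<close>.

  Write \<open>K(a)\<close> for the radical of \<open>\<tau>(a,\<cdot>,\<cdot>)\<close>. Double counting yields \<open>b\<close> such
  that \<open>U = K(b)\<close> has density at least \<open>\<mu>/4\<close> and most \<open>a \<in> U\<close> have \<open>K(a)\<close> of density at
  least \<open>\<mu>/4\<close>; as every element of \<open>U\<close> is a sum of two such, \<open>K(a)\<close> has density at least
  \<open>(\<mu>/4)^2\<close> for all \<open>a \<in> U\<close>. Passing repeatedly to the smallest \<open>K(d)\<close>, \<open>d \<in> U\<close>, halves the
  maximal rank of the forms indexed by \<open>U\<close>, and ends at a subgroup \<open>W\<close> of density at least
  \<open>(\<mu>/4)^4\<close> on which all of them vanish. Then \<open><a,x> = \<tau>(a,x,x) = 0\<close> on \<open>U \<times> W\<close>, so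
  \<open>|U| |W| \<le> 2^N\<close>, which forces \<open>(\<mu>/4)^5 \<le> 2^-N\<close>.
\<close>

text \<open>These rules rewrite the field operations of \<^typ>\<open>bit\<close> to bitwise XOR and AND.\<close>
declare add_bit_eq_xor [simp del] mult_bit_eq_and [simp del]

section \<open>Finite subgroups and sign characters\<close>

definition add_subgroup :: "'a::ab_group_add set \<Rightarrow> bool" where
  "add_subgroup H \<longleftrightarrow> finite H \<and> 0 \<in> H \<and> (\<forall>x\<in>H. \<forall>y\<in>H. x - y \<in> H)"

lemma add_subgroupI:
  assumes "finite H" "0 \<in> H" "\<And>x y. x \<in> H \<Longrightarrow> y \<in> H \<Longrightarrow> x - y \<in> H"
  shows "add_subgroup H"
  using assms by (auto simp: add_subgroup_def)

lemma add_subgroupD: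
  assumes "add_subgroup H"
  shows "finite H" "0 \<in> H" "x \<in> H \<Longrightarrow> y \<in> H \<Longrightarrow> x - y \<in> H"
    "x \<in> H \<Longrightarrow> y \<in> H \<Longrightarrow> x + y \<in> H"
proof -
  show "finite H" "0 \<in> H" and diff: "\<And>x y. x \<in> H \<Longrightarrow> y \<in> H \<Longrightarrow> x - y \<in> H"
    using assms by (auto simp: add_subgroup_def)
  assume "x \<in> H" "y \<in> H"
  then have "x - (0 - y) \<in> H"
    using diff \<open>0 \<in> H\<close> by blast
  then show "x + y \<in> H" by simp
qed

lemma card_add_subgroup_pos: "add_subgroup H \<Longrightarrow> card H > 0"
  by (auto simp: card_gt_0_iff dest: add_subgroupD)

lemma sum_add_subgroup_shift:
  assumes "add_subgroup H" "a \<in> H"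
  shows "(\<Sum>x\<in>H. f (x + a)) = (\<Sum>x\<in>H. f x)"
  by (rule sum.reindex_bij_witness[where i = "\<lambda>x. x - a" and j = "\<lambda>x. x + a"])
    (use assms in \<open>auto dest: add_subgroupD\<close>)

text \<open>Two pairs with the same sum differ by an element of A \<inter> B, so every fibre of
  addition A \<times> B \<rightarrow> C has at most |A \<inter> B| elements.\<close>

lemma card_mult_le_card_Int_mult:
  assumes A: "add_subgroup A" and B: "add_subgroup B" and C: "finite C"
    and sub: "\<And>a b. a \<in> A \<Longrightarrow> b \<in> B \<Longrightarrow> a + b \<in> C"
  shows "card A * card B \<le> card (A \<inter> B) * card C"
proof -
  have fin: "finite A" "finite B"
    using A B by (auto dest: add_subgroupD)
  define F where "F c = {p \<in> A \<times> B. fst p + snd p = c}" for c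
  have fiber: "card (F c) \<le> card (A \<inter> B)" for c
  proof (cases "F c = {}")
    case False
    then obtain a0 b0 where ab0: "a0 \<in> A" "b0 \<in> B" "a0 + b0 = c"
      by (auto simp: F_def)
    have "inj_on (\<lambda>p. fst p - a0) (F c)"
      by (auto simp: inj_on_def F_def)
    moreover have "(\<lambda>p. fst p - a0) ` F c \<subseteq> A \<inter> B"
    proof (rule image_subsetI)
      fix p assume p: "p \<in> F c"
      obtain a b where p_eq: "p = (a, b)" by (cases p)
      with p have "(a, b) \<in> F c" by simp
      then have ab: "a \<in> A" "b \<in> B" "a + b = c" by (auto simp: F_def)
      then have "a - a0 = b0 - b" using ab0 by (simp add: algebra_simps)
      then show "fst p - a0 \<in> A \<inter> B"
        using ab ab0 add_subgroupD(3)[OF A, of a a0] add_subgroupD(3)[OF B, of b0 b] by (simp add: p_eq)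
    qed
    ultimately show ?thesis
      using fin by (intro card_inj_on_le) auto
  qed simp
  have "card A * card B = (\<Sum>p\<in>A \<times> B. 1)"
    by (simp add: card_cartesian_product)
  also have "\<dots> = (\<Sum>c\<in>C. \<Sum>p\<in>F c. 1)"
    unfolding F_def by (rule sum.group[symmetric]) (use fin C sub in auto)
  also have "\<dots> \<le> (\<Sum>c\<in>C. card (A \<inter> B))"
    using fiber by (intro sum_mono) simp
  finally show ?thesis by (simp add: mult.commute)
qed

definition \<chi> :: "bit \<Rightarrow> real" where
  "\<chi> b = (if b = 0 then 1 else -1)"

lemma \<chi>_0 [simp]: "\<chi> 0 = 1"
  and \<chi>_add: "\<chi> (a + b) = \<chi> a * \<chi> b"
  by (auto simp: \<chi>_def)

text \<open>Translating by some a with f a = 1 negates the sum, which therefore vanishes.\<close>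

lemma sum_\<chi>_additive:
  assumes H: "add_subgroup H"
    and add: "\<And>x y. x \<in> H \<Longrightarrow> y \<in> H \<Longrightarrow> f (x + y) = f x + f y"
  shows "(\<Sum>x\<in>H. \<chi> (f x)) = (if \<forall>x\<in>H. f x = 0 then card H else 0)"
proof (cases "\<forall>x\<in>H. f x = 0")
  case False
  then obtain a where a: "a \<in> H" "f a \<noteq> 0" by blast
  then have "\<chi> (f a) = -1" by (simp add: \<chi>_def)
  have "(\<Sum>x\<in>H. \<chi> (f x)) = (\<Sum>x\<in>H. \<chi> (f (x + a)))"
    by (rule sum_add_subgroup_shift[OF H a(1), symmetric])
  also have "\<dots> = (\<Sum>x\<in>H. - \<chi> (f x))"
    using add a \<open>\<chi> (f a) = -1\<close> by (intro sum.cong) (auto simp: \<chi>_add)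
  finally show ?thesis using False by (auto simp: sum_negf)
qed simp

section \<open>The bias of a symmetric trilinear form\<close>

locale symmetric_trilinear =
  fixes G :: "'a::ab_group_add set" and \<tau> :: "'a \<Rightarrow> 'a \<Rightarrow> 'a \<Rightarrow> bit"
  assumes G: "add_subgroup G"
    and add1: "\<lbrakk>a \<in> G; b \<in> G; x \<in> G; y \<in> G\<rbrakk> \<Longrightarrow> \<tau> (a + b) x y = \<tau> a x y + \<tau> b x y"
    and sym12: "\<lbrakk>x \<in> G; y \<in> G; z \<in> G\<rbrakk> \<Longrightarrow> \<tau> x y z = \<tau> y x z"
    and sym23: "\<lbrakk>x \<in> G; y \<in> G; z \<in> G\<rbrakk> \<Longrightarrow> \<tau> x y z = \<tau> x z y"
begin

lemma diff1:
  assumes "a \<in> G" "b \<in> G" "x \<in> G" "y \<in> G"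
  shows "\<tau> (a - b) x y = \<tau> a x y - \<tau> b x y"
  using add1[of "a - b" b x y] assms add_subgroupD(3)[OF G] by simp

lemma add2:
  assumes "a \<in> G" "x \<in> G" "y \<in> G" "z \<in> G"
  shows "\<tau> a (x + y) z = \<tau> a x z + \<tau> a y z"
  using assms add1[of x y a z] sym12 add_subgroupD(4)[OF G] by metis

lemma diff2:
  assumes "a \<in> G" "x \<in> G" "y \<in> G" "z \<in> G"
  shows "\<tau> a (x - y) z = \<tau> a x z - \<tau> a y z"
  using assms diff1[of x y a z] sym12 add_subgroupD(3)[OF G] by metis

lemma zero1: "x \<in> G \<Longrightarrow> y \<in> G \<Longrightarrow> \<tau> 0 x y = 0"
  using diff1[of 0 0 x y] add_subgroupD(2)[OF G] by simp

lemma zero2: "x \<in> G \<Longrightarrow> y \<in> G \<Longrightarrow> \<tau> x 0 y = 0"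
  using diff2[of x 0 0 y] add_subgroupD(2)[OF G] by simp

text \<open>The sets K(a) of the overview are \<open>rad G a\<close>. The ambient V varies because
  the rank argument restricts all forms to smaller and smaller subgroups.\<close>

definition rad :: "'a set \<Rightarrow> 'a \<Rightarrow> 'a set" where
  "rad V a = {x \<in> V. \<forall>y\<in>V. \<tau> a x y = 0}"

lemma rad_subset: "rad V a \<subseteq> V"
  by (auto simp: rad_def)

lemma add_subgroup_rad:
  assumes "add_subgroup V" "V \<subseteq> G" "a \<in> G"
  shows "add_subgroup (rad V a)"
proof (rule add_subgroupI)
  show "finite (rad V a)"
    using assms add_subgroupD(1) rad_subset finite_subset by metis
  show "0 \<in> rad V a"
    using assms zero2 by (auto simp: rad_def dest: add_subgroupD)
  show "x - y \<in> rad V a" if "x \<in> rad V a" "y \<in> rad V a" for x y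
    using that assms diff2[of a x y] by (auto simp: rad_def subset_iff dest: add_subgroupD)
qed

text \<open>In terms of ranks of bilinear forms:
  \<open>rank L + rank (L + D) \<ge> 2 * rank (L restricted to ker D) + rank D\<close>.\<close>
lemma card_rad_mult_le:
  assumes V: "add_subgroup V" "V \<subseteq> G" and a: "a \<in> G" "d \<in> G"
  defines "W \<equiv> rad V d"
  shows "card (rad V a) * card (rad V (a + d)) * card W \<le> (card (rad W a))\<^sup>2 * card V"
proof -
  define K K' where "K = rad V a" and "K' = rad V (a + d)"
  have ad: "a + d \<in> G" using G a add_subgroupD(4) by blast
  have K: "add_subgroup K" and K': "add_subgroup K'" and W: "add_subgroup W"
    unfolding K_def K'_def W_def using V a ad add_subgroup_rad by blast+
  have fin: "finite V" "finite W" using V W add_subgroupD by blast+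
  have WV: "W \<subseteq> V" "K \<subseteq> V" "K' \<subseteq> V" by (auto simp: W_def K_def K'_def rad_def)
  have add: "\<tau> (a + d) x y = \<tau> a x y + \<tau> d x y" if "x \<in> V" "y \<in> V" for x y
    using add1 that V a by blast
  \<comment> \<open>P = K + K' links the two product bounds: |K| |K'| is compared with |P|, then |P|
    |W| with |V|. Both intersections that arise lie in \<open>rad W a\<close>.\<close>
  define P where "P = (\<lambda>(x, y). x + y) ` (K \<times> K')"
  have PV: "P \<subseteq> V" using WV V by (auto simp: P_def dest: add_subgroupD)
  have P: "add_subgroup P"
  proof (rule add_subgroupI)
    show "finite P" using PV fin finite_subset by blast
    have "(0, 0) \<in> K \<times> K'" using K K' add_subgroupD(2) by blast
    then show "0 \<in> P" by (force simp: P_def)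
    fix p q assume "p \<in> P" "q \<in> P"
    then obtain x y x' y' where xy: "x \<in> K" "y \<in> K'" "x' \<in> K" "y' \<in> K'" "p = x + y" "q = x' + y'"
      by (auto simp: P_def)
    then have "x - x' \<in> K" "y - y' \<in> K'" "p - q = (x - x') + (y - y')"
      using K K' add_subgroupD(3) by (blast, blast, simp)
    then show "p - q \<in> P" by (force simp: P_def)
  qed
  have "card K * card K' \<le> card (K \<inter> K') * card P"
    using K K' P by (intro card_mult_le_card_Int_mult) (auto simp: P_def dest: add_subgroupD)
  moreover have "card P * card W \<le> card (P \<inter> W) * card V"
    using P W V PV WV by (intro card_mult_le_card_Int_mult) (auto dest: add_subgroupD)
  moreover have "card (K \<inter> K') \<le> card (rad W a)"
  proof (rule card_mono)
    show "finite (rad W a)" using fin rad_subset finite_subset by blast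
    show "K \<inter> K' \<subseteq> rad W a"
      using add by (auto simp: K_def K'_def W_def rad_def)
  qed
  moreover have "card (P \<inter> W) \<le> card (rad W a)"
  proof (rule card_mono)
    show "finite (rad W a)" using fin rad_subset finite_subset by blast
    show "P \<inter> W \<subseteq> rad W a"
    proof
      fix p assume p: "p \<in> P \<inter> W"
      then obtain x y where xy: "x \<in> K" "y \<in> K'" "p = x + y" by (auto simp: P_def)
      \<comment> \<open>Against w in the radical of d, the forms of a and a + d agree, so the
        K'-part of p is annihilated as well as the K-part.\<close>
      have "\<tau> a p w = 0" if w: "w \<in> W" for w
      proof -
        have mem: "x \<in> V" "y \<in> V" "w \<in> V" using xy w WV by auto
        have "\<tau> d y w = \<tau> d w y" using sym23 mem V a by blast
        also have "\<dots> = 0" using w mem by (auto simp: W_def rad_def)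
        finally have "\<tau> a y w = 0"
          using add[OF mem(2,3)] xy mem by (auto simp: K'_def rad_def)
        moreover have "\<tau> a x w = 0" using xy mem by (auto simp: K_def rad_def)
        ultimately show ?thesis
          using add2[of a x y w] mem V a xy by auto
      qed
      then show "p \<in> rad W a" using p by (auto simp: rad_def)
    qed
  qed
  ultimately have le: "card K * card K' \<le> card (rad W a) * card P"
    "card P * card W \<le> card (rad W a) * card V"
    by (meson mult_le_mono1 le_trans)+
  have "card K * card K' * card W \<le> card (rad W a) * (card P * card W)"
    using le(1) mult_le_mono1 by (fastforce simp: mult.assoc)
  also have "\<dots> \<le> card (rad W a) * (card (rad W a) * card V)"
    using le(2) by (rule mult_le_mono2)
  finally show ?thesis
    by (simp add: K_def K'_def power2_eq_square mult.assoc)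
qed

text \<open>A smallest radical W = \<open>rad V d\<close> belongs to a form of maximal rank r. By
  \<open>card_rad_mult_le\<close> the forms restricted to W have rank at most r/2, so the total
  codimension is at most r + r/2 + ... \<le> 2r; this is the source of the square in the
  bound.\<close>

lemma exists_common_isotropic_subgroup:
  assumes U: "add_subgroup U" "U \<subseteq> G"
    and V: "add_subgroup V" "V \<subseteq> G"
    and m: "\<And>a. a \<in> U \<Longrightarrow> m \<le> card (rad V a)"
  shows "\<exists>W. add_subgroup W \<and> W \<subseteq> V \<and> (\<forall>a\<in>U. \<forall>x\<in>W. \<forall>y\<in>W. \<tau> a x y = 0) \<and> m\<^sup>2 \<le> card V * card W"
  using V m
proof (induction "card V" arbitrary: V m rule: less_induct)
  case less
  have U0: "U \<noteq> {}" and finU: "finite U" using U add_subgroupD by auto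
  have finV: "finite V" using less.prems add_subgroupD by auto
  have min: "\<exists>d\<in>U. \<forall>a\<in>U. card (rad X d) \<le> card (rad X a)" for X
    using ex_min_if_finite[of "(\<lambda>a. card (rad X a)) ` U"] finU U0 by (fastforce simp: not_less)
  obtain d where d: "d \<in> U" "\<And>a. a \<in> U \<Longrightarrow> card (rad V d) \<le> card (rad V a)"
    using min by blast
  define W where "W = rad V d"
  have dG: "d \<in> G" using d U by blast
  have W: "add_subgroup W" "W \<subseteq> V" "W \<subseteq> G"
    using add_subgroup_rad[of V d] less.prems dG rad_subset[of V d] by (auto simp: W_def)
  have mW: "m \<le> card W" using less.prems d by (simp add: W_def)
  show ?case
  proof (cases "W = V")
    case True
    have "rad V a = V" if "a \<in> U" for a
      using d(2)[OF that] True finV rad_subset[of V a]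
      by (metis W_def card_subset_eq card_mono le_antisym)
    then have "\<forall>a\<in>U. \<forall>x\<in>V. \<forall>y\<in>V. \<tau> a x y = 0"
      by (auto simp: rad_def)
    moreover have "m\<^sup>2 \<le> card V * card V"
      using mW True by (simp add: power2_eq_square mult_le_mono)
    ultimately show ?thesis using less.prems by blast
  next
    case False
    then have lt: "card W < card V" using W finV by (simp add: psubset_card_mono psubsetI)
    obtain e where e: "e \<in> U" "\<And>a. a \<in> U \<Longrightarrow> card (rad W e) \<le> card (rad W a)"
      using min by blast
    obtain W' where W': "add_subgroup W'" "W' \<subseteq> W" "\<forall>a\<in>U. \<forall>x\<in>W'. \<forall>y\<in>W'. \<tau> a x y = 0"
      "(card (rad W e))\<^sup>2 \<le> card W * card W'"
      \<comment> \<open>The induction runs with the smallest radical size inside W in place of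
        m.\<close>
      using less.hyps[OF lt W(1,3) e(2)] by blast
    have ed: "e + d \<in> U" using e d U add_subgroupD(4) by blast
    \<comment> \<open>Both e and e + d lie in U, so by the choice of d their radicals in V have at
      least |W| elements.\<close>
    have "card W * card W * card W \<le> card (rad V e) * card (rad V (e + d)) * card W"
      using d(2)[OF e(1)] d(2)[OF ed] by (simp add: W_def mult_le_mono)
    also have "\<dots> \<le> (card (rad W e))\<^sup>2 * card V"
      unfolding W_def using less.prems e dG U by (intro card_rad_mult_le) auto
    also have "\<dots> \<le> card W * card W' * card V"
      using W'(4) by simp
    finally have "card W * card W \<le> card W' * card V"
      using card_add_subgroup_pos[OF W(1)] by (simp add: mult.assoc)
    then have "m\<^sup>2 \<le> card V * card W'"
      using mult_le_mono[OF mW mW] by (simp add: power2_eq_square mult.commute)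
    then show ?thesis using W' W by blast
  qed
qed

text \<open>The sum over c is a character sum: it equals |G| if b lies in the radical of a and
  vanishes otherwise.\<close>

lemma sum_\<chi>_eq_sum_card_rad:
  "(\<Sum>a\<in>G. \<Sum>b\<in>G. \<Sum>c\<in>G. \<chi> (\<tau> a b c)) = card G * (\<Sum>a\<in>G. real (card (rad G a)))"
proof -
  have fin: "finite G" using G add_subgroupD by blast
  have "(\<Sum>b\<in>G. \<Sum>c\<in>G. \<chi> (\<tau> a b c)) = card G * real (card (rad G a))" if a: "a \<in> G" for a
  proof -
    have "(\<Sum>c\<in>G. \<chi> (\<tau> a b c)) = (if b \<in> rad G a then card G else 0)" if b: "b \<in> G" for b
    proof -
      have "\<tau> a b (x + y) = \<tau> a b x + \<tau> a b y" if "x \<in> G" "y \<in> G" for x y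
        using add2[of a x y b] sym23 a b that add_subgroupD(4)[OF G] by metis
      then show ?thesis
        using sum_\<chi>_additive[OF G, of "\<tau> a b"] b by (simp add: rad_def)
    qed
    then have "(\<Sum>b\<in>G. \<Sum>c\<in>G. \<chi> (\<tau> a b c)) = (\<Sum>b\<in>G. if b \<in> rad G a then real (card G) else 0)"
      by (intro sum.cong) auto
    also have "\<dots> = (\<Sum>b\<in>rad G a. real (card G))"
      using fin rad_subset[of G a] by (simp add: sum.inter_restrict[symmetric] Int_absorb1)
    finally show ?thesis by simp
  qed
  then show ?thesis by (simp add: sum_distrib_left)
qed

text \<open>The maps x \<mapsto> \<open>\<chi> (\<tau> a x x)\<close> are characters of G, distinct
  for distinct a by nondegeneracy. The second moment over G of their sum over U is |U| |G| by
  orthogonality, while W alone contributes |W| |U|^2.\<close>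

lemma card_mult_le_of_orthogonal:
  assumes nondeg: "\<And>a. a \<in> G \<Longrightarrow> (\<And>x. x \<in> G \<Longrightarrow> \<tau> a x x = 0) \<Longrightarrow> a = 0"
    and U: "add_subgroup U" "U \<subseteq> G" and W: "W \<subseteq> G"
    and orth: "\<And>a x. a \<in> U \<Longrightarrow> x \<in> W \<Longrightarrow> \<tau> a x x = 0"
  shows "card U * card W \<le> card G"
proof -
  have fin: "finite G" "finite U" using G U add_subgroupD by blast+
  \<comment> \<open>By symmetry the two cross terms are equal, so they cancel in characteristic
    2.\<close>
  have diag: "\<tau> a (x + y) (x + y) = \<tau> a x x + \<tau> a y y" if "a \<in> G" "x \<in> G" "y \<in> G" for a x y
  proof -
    have xy: "x + y \<in> G" using that add_subgroupD(4)[OF G] by blast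
    have "\<tau> a x (x + y) = \<tau> a x x + \<tau> a y x" "\<tau> a y (x + y) = \<tau> a x y + \<tau> a y y"
      using add2[of a x y x] add2[of a x y y] sym23[of a x "x + y"] sym23[of a y "x + y"] that xy
      by simp_all
    moreover have "\<tau> a x y = \<tau> a y x" using sym23 that by blast
    ultimately show ?thesis
      using add2[of a x y "x + y"] that xy by (simp add: algebra_simps)
  qed
  have inner: "(\<Sum>x\<in>G. \<chi> (\<tau> a x x)) = (if a = 0 then card G else 0)" if "a \<in> G" for a
    using sum_\<chi>_additive[OF G, of "\<lambda>x. \<tau> a x x"] diag nondeg zero1 that by auto
  have prod: "\<chi> (\<tau> a x x) * \<chi> (\<tau> b x x) = \<chi> (\<tau> (b - a) x x)" if "a \<in> U" "b \<in> U" "x \<in> G" for a b x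
  proof -
    have "a \<in> G" "b \<in> G" using that U by blast+
    then show ?thesis using diff1[of b a x x] that(3) by (auto simp: \<chi>_def)
  qed
  have "real (card W) * (real (card U))\<^sup>2 = (\<Sum>x\<in>W. (\<Sum>a\<in>U. \<chi> (\<tau> a x x))\<^sup>2)"
    using orth by simp
  also have "\<dots> \<le> (\<Sum>x\<in>G. (\<Sum>a\<in>U. \<chi> (\<tau> a x x))\<^sup>2)"
    using fin W by (intro sum_mono2) auto
  also have "\<dots> = (\<Sum>x\<in>G. \<Sum>a\<in>U. \<Sum>b\<in>U. \<chi> (\<tau> (b - a) x x))"
    using prod by (intro sum.cong) (auto simp: power2_eq_square sum_product intro!: sum.cong)
  also have "\<dots> = (\<Sum>a\<in>U. \<Sum>b\<in>U. \<Sum>x\<in>G. \<chi> (\<tau> (b - a) x x))"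
    by (subst sum.swap) (intro sum.cong refl sum.swap)
  also have "\<dots> = (\<Sum>a\<in>U. \<Sum>b\<in>U. if b = a then real (card G) else 0)"
    using U by (intro sum.cong refl) (subst inner, auto dest: add_subgroupD)
  also have "\<dots> = real (card U) * card G"
    using fin by simp
  finally have "real (card U * card W) * card U \<le> real (card G) * card U"
    by (simp add: power2_eq_square mult_ac)
  then have "real (card U * card W) \<le> real (card G)"
    using card_add_subgroup_pos[OF U(1)] by (metis mult_le_cancel_right_pos of_nat_0_less_iff)
  then show ?thesis by linarith
qed

text \<open>Averaging over b gives a radical whose elements in the popular set A outnumber those
  outside by more than (\<mu>/4)|G|. This surplus makes U large and places more than half of it in
  A.\<close>

lemma exists_rad_with_large_rads:
  fixes \<mu> :: real
  assumes pos: "\<mu> > 0"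
    and sum: "(\<Sum>a\<in>G. real (card (rad G a))) = \<mu> * (real (card G))\<^sup>2"
  shows "\<exists>U. add_subgroup U \<and> U \<subseteq> G \<and> real (card U) \<ge> \<mu> / 4 * card G \<and>
    (\<forall>a\<in>U. real (card (rad G a)) \<ge> (\<mu> / 4)\<^sup>2 * card G)"
proof -
  have fin: "finite G" using G add_subgroupD by blast
  have finr: "finite (rad G a)" for a using fin rad_subset finite_subset by blast
  define M where "M = real (card G)"
  have M: "M > 0" using card_add_subgroup_pos[OF G] by (simp add: M_def)
  define A where "A = {a \<in> G. real (card (rad G a)) \<ge> \<mu> / 4 * M}"
  \<comment> \<open>Double counting, since membership of a in the radical of b is symmetric in a and
    b.\<close>
  have swap: "(\<Sum>b\<in>G. real (card (rad G b \<inter> X))) = (\<Sum>a\<in>X. real (card (rad G a)))"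
    if X: "X \<subseteq> G" for X
  proof -
    have finX: "finite X" using X fin finite_subset by blast
    have symm: "a \<in> rad G b \<longleftrightarrow> b \<in> rad G a" if "a \<in> G" "b \<in> G" for a b
      using that sym12 by (auto simp: rad_def)
    have "(\<Sum>b\<in>G. real (card (rad G b \<inter> X))) = (\<Sum>b\<in>G. \<Sum>a\<in>X. if a \<in> rad G b then 1 else 0)"
      using finX by (intro sum.cong refl) (simp add: sum.inter_restrict[symmetric] Int_commute)
    also have "\<dots> = (\<Sum>a\<in>X. \<Sum>b\<in>G. if b \<in> rad G a then 1 else 0)"
      by (subst sum.swap) (use symm X in \<open>auto intro!: sum.cong\<close>)
    also have "\<dots> = (\<Sum>a\<in>X. real (card (G \<inter> rad G a)))"
      using fin by (intro sum.cong refl) (simp add: sum.inter_restrict[symmetric])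
    finally show ?thesis by (simp add: Int_absorb1 rad_subset)
  qed
  have bad: "(\<Sum>a\<in>G - A. real (card (rad G a))) \<le> \<mu> / 4 * M * M"
  proof -
    have "(\<Sum>a\<in>G - A. real (card (rad G a))) \<le> (\<Sum>a\<in>G - A. \<mu> / 4 * M)"
      by (intro sum_mono) (auto simp: A_def)
    also have "\<dots> = card (G - A) * (\<mu> / 4 * M)" by simp
    also have "\<dots> \<le> M * (\<mu> / 4 * M)"
      using pos M fin by (intro mult_right_mono) (auto simp: M_def intro!: card_mono)
    finally show ?thesis by (simp add: mult_ac)
  qed
  have AG: "A \<subseteq> G" by (auto simp: A_def)
  have tot: "(\<Sum>a\<in>A. real (card (rad G a))) + (\<Sum>a\<in>G - A. real (card (rad G a))) = \<mu> * M * M"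
    using sum.subset_diff[OF AG fin, of "\<lambda>a. real (card (rad G a))"] sum
    by (simp add: M_def power2_eq_square)
  \<comment> \<open>Otherwise the total \<mu> M^2 would be at most twice the contribution of G - A
    plus (\<mu>/4) M^2, hence at most three quarters of itself.\<close>
  have "\<exists>b\<in>G. real (card (rad G b \<inter> A)) > real (card (rad G b \<inter> (G - A))) + \<mu> / 4 * M"
  proof (rule ccontr)
    assume "\<not> ?thesis"
    then have "(\<Sum>b\<in>G. real (card (rad G b \<inter> A)))
        \<le> (\<Sum>b\<in>G. real (card (rad G b \<inter> (G - A))) + \<mu> / 4 * M)"
      by (intro sum_mono) (auto simp: not_less)
    also have "\<dots> = (\<Sum>b\<in>G. real (card (rad G b \<inter> (G - A)))) + \<mu> / 4 * M * M"
      by (simp add: sum.distrib M_def)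
    finally have "(\<Sum>a\<in>A. real (card (rad G a))) \<le> (\<Sum>a\<in>G - A. real (card (rad G a))) + \<mu> / 4 * M * M"
      using swap[OF AG] swap[of "G - A"] by auto
    then have "\<mu> * M * M \<le> 3 * (\<mu> / 4 * M * M)"
      using bad tot by linarith
    moreover have "\<mu> * M * M > 0" using pos M by simp
    ultimately show False by linarith
  qed
  then obtain b where b: "b \<in> G"
    "real (card (rad G b \<inter> A)) > real (card (rad G b \<inter> (G - A))) + \<mu> / 4 * M" by blast
  define U where "U = rad G b"
  have U: "add_subgroup U" "U \<subseteq> G"
    using add_subgroup_rad[OF G order.refl b(1)] rad_subset by (auto simp: U_def)
  have finU: "finite U" using U add_subgroupD by blast
  have cardU: "card U = card (U \<inter> A) + card (U \<inter> (G - A))"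
    using finU U by (subst card_Un_disjoint[symmetric]) (auto intro!: arg_cong[where f = card])
  have "real (card U) \<ge> \<mu> / 4 * card G"
    using b(2) cardU by (simp add: U_def M_def)
  moreover have "real (card (rad G a)) \<ge> (\<mu> / 4)\<^sup>2 * card G" if a: "a \<in> U" for a
  proof -
    define B where "B = (\<lambda>x. a - x) ` (U \<inter> A)"
    have cB: "card B = card (U \<inter> A)"
      unfolding B_def by (rule card_image) (auto simp: inj_on_def)
    have BU: "B \<subseteq> U" using a U by (auto simp: B_def dest: add_subgroupD)
    have "\<mu> * M > 0" using pos M by simp
    \<comment> \<open>Pigeonhole: \<open>U \<inter> A\<close> and its reflection \<open>B\<close>
      each fill more than half of U. A common point writes a as a sum of two elements of A.\<close>
    have "B \<inter> (U \<inter> A) \<noteq> {}"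
    proof
      assume "B \<inter> (U \<inter> A) = {}"
      then have "card B + card (U \<inter> A) = card (B \<union> (U \<inter> A))"
        using finU BU finite_subset by (subst card_Un_disjoint) auto
      also have "\<dots> \<le> card U" using finU BU by (intro card_mono) auto
      finally have "card (U \<inter> A) \<le> card (U \<inter> (G - A))" using cB cardU by linarith
      then show False using b(2) \<open>\<mu> * M > 0\<close> by (simp add: U_def)
    qed
    then obtain x where x: "x \<in> A" "a - x \<in> A" by (auto simp: B_def)
    then have xG: "x \<in> G" "a - x \<in> G" by (auto simp: A_def)
    have sub: "rad G x \<inter> rad G (a - x) \<subseteq> rad G a"
      using add1[of x "a - x"] xG by (auto simp: rad_def)
    have "(\<mu> / 4)\<^sup>2 * M * M = (\<mu> / 4 * M) * (\<mu> / 4 * M)" by (simp add: power2_eq_square)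
    also have "\<dots> \<le> real (card (rad G x)) * real (card (rad G (a - x)))"
      using x pos M by (intro mult_mono) (auto simp: A_def)
    also have "\<dots> \<le> real (card (rad G x \<inter> rad G (a - x)) * card G)"
      unfolding of_nat_mult[symmetric] of_nat_le_iff
      using xG G fin rad_subset add_subgroup_rad[OF G order.refl]
      by (intro card_mult_le_card_Int_mult) (auto simp: subset_iff dest: add_subgroupD)
    also have "\<dots> \<le> real (card (rad G a)) * M"
      unfolding of_nat_mult M_def using card_mono[OF finr sub] by (intro mult_right_mono) auto
    finally show ?thesis using M by (simp add: M_def)
  qed
  ultimately show ?thesis using U by blast
qed

text \<open>With M = |G|, the bounds |U| \<ge> (\<mu>/4) M, M |W| \<ge> ((\<mu>/4)^2 M)^2 and |U|
  |W| \<le> M multiply to (\<mu>/4)^5 M^3 \<le> M^2.\<close>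

theorem sum_\<chi>_bound:
  assumes nondeg: "\<And>a. a \<in> G \<Longrightarrow> (\<And>x. x \<in> G \<Longrightarrow> \<tau> a x x = 0) \<Longrightarrow> a = 0"
    and \<mu>: "(\<Sum>a\<in>G. \<Sum>b\<in>G. \<Sum>c\<in>G. \<chi> (\<tau> a b c)) = \<mu> * real (card G) ^ 3"
  shows "(\<mu> / 4) ^ 5 * card G \<le> 1"
proof (cases "\<mu> > 0")
  case True
  define M where "M = real (card G)"
  have M: "M > 0" using card_add_subgroup_pos[OF G] by (simp add: M_def)
  have "(\<Sum>a\<in>G. real (card (rad G a))) = \<mu> * (real (card G))\<^sup>2"
    using \<mu> M unfolding sum_\<chi>_eq_sum_card_rad M_def[symmetric]
    by (simp add: power2_eq_square power3_eq_cube)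
  then obtain U where U: "add_subgroup U" "U \<subseteq> G" "real (card U) \<ge> \<mu> / 4 * M"
    "\<And>a. a \<in> U \<Longrightarrow> real (card (rad G a)) \<ge> (\<mu> / 4)\<^sup>2 * M"
    using exists_rad_with_large_rads[OF True] unfolding M_def by blast
  define m where "m = nat \<lceil>(\<mu> / 4)\<^sup>2 * M\<rceil>"
  have "m \<le> card (rad G a)" if "a \<in> U" for a
    using U(4)[OF that] unfolding m_def by linarith
  then obtain W where W: "W \<subseteq> G" "\<forall>a\<in>U. \<forall>x\<in>W. \<forall>y\<in>W. \<tau> a x y = 0" "m\<^sup>2 \<le> card G * card W"
    using exists_common_isotropic_subgroup[OF U(1,2) G order.refl] by metis
  have UW: "card U * card W \<le> card G"
    using card_mult_le_of_orthogonal[OF nondeg U(1,2) W(1)] W(2) by blast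
  have "((\<mu> / 4)\<^sup>2 * M)\<^sup>2 \<le> (real m)\<^sup>2"
    unfolding m_def using True M by (intro power_mono) (auto simp: of_nat_ceiling)
  also have "\<dots> \<le> M * card W"
    using W(3) unfolding M_def by (metis of_nat_le_iff of_nat_mult of_nat_power)
  finally have "(\<mu> / 4 * M) * ((\<mu> / 4)\<^sup>2 * M)\<^sup>2 \<le> card U * (M * card W)"
    using U(3) True M by (intro mult_mono) auto
  also have "\<dots> \<le> M * M"
    using UW M by (simp add: mult.left_commute M_def flip: of_nat_mult)
  finally have "((\<mu> / 4) ^ 5 * M) * (M * M) \<le> 1 * (M * M)"
    by (simp add: power2_eq_square eval_nat_numeral mult_ac)
  then show ?thesis using M unfolding M_def[symmetric]
    by (metis mult_le_cancel_right_pos mult_pos_pos)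
next
  case False
  \<comment> \<open>An odd power of a nonpositive number is nonpositive.\<close>
  then have "(\<mu> / 4) ^ 5 \<le> 0" by (simp add: power_le_zero_eq)
  then show ?thesis by (smt (verit) mult_nonpos_nonneg of_nat_0_le_iff)
qed

end

section \<open>Derivatives of polynomial functions\<close>

lemma bit_add_self [simp]: "(b::bit) + b = 0" "(b::bit) + (b + c) = c"
  by (cases b; cases c; simp)+

lemma fun_bit_add_self: "(x :: 'a \<Rightarrow> bit) + x = 0" "x + (x + y) = y" for y :: "'a \<Rightarrow> bit"
  by (simp_all add: fun_eq_iff)

definition dif :: "(nat \<Rightarrow> bit) \<Rightarrow> ((nat \<Rightarrow> bit) \<Rightarrow> bit) \<Rightarrow> (nat \<Rightarrow> bit) \<Rightarrow> bit" where
  "dif a f x = f (x + a) + f x"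

text \<open>Degree below d is encoded as the vanishing of all d-fold derivatives, the form in which
  the cubic g enters the argument.\<close>

fun deg_less :: "nat \<Rightarrow> ((nat \<Rightarrow> bit) \<Rightarrow> bit) \<Rightarrow> bool" where
  "deg_less 0 f \<longleftrightarrow> (\<forall>x. f x = 0)"
| "deg_less (Suc d) f \<longleftrightarrow> (\<forall>a. deg_less d (dif a f))"

lemma deg_less_0: "deg_less d (\<lambda>x. 0)"
  by (induction d) (simp_all add: dif_def[abs_def])

lemma deg_less_add:
  "deg_less d f \<Longrightarrow> deg_less d g \<Longrightarrow> deg_less d (\<lambda>x. f x + g x)"
proof (induction d arbitrary: f g)
  case (Suc d)
  have "dif a (\<lambda>x. f x + g x) = (\<lambda>x. dif a f x + dif a g x)" for a
    by (simp add: dif_def fun_eq_iff add_ac)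
  with Suc show ?case by simp
qed simp

lemma deg_less_cmult: "deg_less d f \<Longrightarrow> deg_less d (\<lambda>x. c * f x)"
  by (cases c) (simp_all add: deg_less_0)

lemma deg_less_sum: "(\<And>t. t \<in> T \<Longrightarrow> deg_less d (f t)) \<Longrightarrow> deg_less d (\<lambda>x. \<Sum>t\<in>T. f t x)"
  by (induction T rule: infinite_finite_induct) (simp_all add: deg_less_0 deg_less_add)

lemma deg_less_shift: "deg_less d f \<Longrightarrow> deg_less d (\<lambda>x. f (x + a))"
proof (induction d arbitrary: f)
  case (Suc d)
  have "dif b (\<lambda>x. f (x + a)) = (\<lambda>x. dif b f (x + a))" for b
    by (simp add: dif_def fun_eq_iff add_ac)
  then show ?case using Suc by (metis deg_less.simps(2))
qed simp

lemma deg_less_Suc: "deg_less d f \<Longrightarrow> deg_less (Suc d) f"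
proof (induction d arbitrary: f)
  case (Suc d)
  then show ?case by (metis deg_less.simps(2))
qed (simp add: dif_def)

lemma deg_less_mono: "d \<le> d' \<Longrightarrow> deg_less d f \<Longrightarrow> deg_less d' f"
  by (induction d' rule: dec_induct) (auto intro: deg_less_Suc simp del: deg_less.simps)

text \<open>Induction by the Leibniz rule D_a(x_i f) = x_i D_a f + a_i f(x + a): the first term has
  lower degree in f, the second is a shift of f.\<close>

lemma deg_less_coord_mult: "deg_less d f \<Longrightarrow> deg_less (Suc d) (\<lambda>x. x i * f x)"
proof (induction d arbitrary: f)
  case 0
  then show ?case by (simp add: dif_def)
next
  case (Suc d)
  have "deg_less (Suc d) (dif a (\<lambda>x. x i * f x))" for a
  proof -
    have "dif a (\<lambda>x. x i * f x) = (\<lambda>x. x i * dif a f x + a i * f (x + a))"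
      by (simp add: dif_def fun_eq_iff algebra_simps)
    moreover have "deg_less (Suc d) (\<lambda>x. x i * dif a f x)"
      using Suc by (intro Suc.IH) simp
    moreover have "deg_less (Suc d) (\<lambda>x. a i * f (x + a))"
      using Suc.prems by (intro deg_less_cmult deg_less_shift)
    ultimately show ?thesis by (simp only: deg_less_add)
  qed
  then show ?case by (subst deg_less.simps) blast
qed

lemma deg_less_monomial: "finite T \<Longrightarrow> deg_less (Suc (card T)) (\<lambda>x. \<Prod>i\<in>T. x i)"
proof (induction T rule: finite_induct)
  case (insert i T)
  then show ?case
    using deg_less_coord_mult[of "Suc (card T)" "\<lambda>x. \<Prod>i\<in>T. x i" i] by (simp del: deg_less.simps)
qed (simp add: dif_def)

lemma deg_less_poly_fun: "deg_less (Suc d) (poly_fun N d c)"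
proof -
  have "deg_less (Suc d) (\<lambda>x. c T * (\<Prod>i\<in>T. x i))" if "T \<subseteq> {..<N}" "card T \<le> d" for T
    using that finite_subset[OF that(1)]
    by (intro deg_less_cmult deg_less_mono[OF _ deg_less_monomial]) auto
  then show ?thesis
    unfolding poly_fun_def[abs_def] by (intro deg_less_sum) blast
qed

lemma dif_commute: "dif a (dif b f) = dif b (dif a f)"
  by (simp add: dif_def fun_eq_iff add_ac)

lemma dif_self: "dif a (dif a f) x = 0"
  by (simp add: dif_def add.assoc fun_bit_add_self)

lemma dif_add: "dif (a + b) f x = dif a f (x + b) + dif b f x"
  by (simp add: dif_def add_ac)

text \<open>The vanishing fourth derivative, taken at 0 with x as its last direction, is the
  difference of the two sides.\<close>

lemma dif3_const:
  assumes "deg_less 4 f"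
  shows "dif a (dif b (dif c f)) x = dif a (dif b (dif c f)) 0"
proof -
  have "dif x (dif a (dif b (dif c f))) 0 = 0"
    using assms by (simp add: eval_nat_numeral)
  then show ?thesis
    by (subst (asm) dif_def) (simp add: add_eq_0_iff2)
qed

section \<open>The cube and the trilinear form of a cubic phase\<close>

lemma add_subgroup_cube: "add_subgroup (cube N)"
  and card_cube: "card (cube N) = 2 ^ N"
proof -
  have bij: "bij_betw (\<lambda>x. {i. x i = 1}) (cube N) (Pow {..<N})"
  proof (rule bij_betwI[where g = "\<lambda>A i. of_bool (i \<in> A)"])
    show "(\<lambda>x. {i. x i = 1}) \<in> cube N \<rightarrow> Pow {..<N}"
      by (auto simp: cube_def) (metis not_le zero_neq_one)
    show "(\<lambda>A i. of_bool (i \<in> A)) \<in> Pow {..<N} \<rightarrow> cube N"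
      by (auto simp: cube_def)
  qed (auto simp: fun_eq_iff of_bool_def)
  show "card (cube N) = 2 ^ N"
    using bij_betw_same_card[OF bij] by (simp add: card_Pow)
  show "add_subgroup (cube N)"
    using bij_betw_finite[OF bij] by (intro add_subgroupI) (auto simp: cube_def)
qed

text \<open>This is \<tau> of the overview. The base point 0 is immaterial when g has degree at most
  3, by \<open>dif3_const\<close>.\<close>

definition cubic_form :: "nat \<Rightarrow> ((nat \<Rightarrow> bit) \<Rightarrow> bit) \<Rightarrow> (nat \<Rightarrow> bit) \<Rightarrow> (nat \<Rightarrow> bit) \<Rightarrow> (nat \<Rightarrow> bit) \<Rightarrow> bit" where
  "cubic_form N g a b c = (\<Sum>i<N. a i * b i * c i) + dif c (dif b (dif a g)) 0"

lemma symmetric_trilinear_cubic_form: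
  assumes g: "deg_less 4 g"
  shows "symmetric_trilinear (cube N) (cubic_form N g)"
proof
  show "add_subgroup (cube N)" by (rule add_subgroup_cube)
  show "cubic_form N g (a + b) x y = cubic_form N g a x y + cubic_form N g b x y" for a b x y
  proof -
    \<comment> \<open>With a + b as the outermost direction, \<open>dif_add\<close> leaves a shift
      by b, which the constant third derivative absorbs.\<close>
    have "dif y (dif x (dif (a + b) g)) 0 = dif (a + b) (dif y (dif x g)) 0"
      by (metis dif_commute)
    also have "\<dots> = dif a (dif y (dif x g)) 0 + dif b (dif y (dif x g)) 0"
      using dif3_const[OF g, of a y x b] by (simp add: dif_add)
    also have "\<dots> = dif y (dif x (dif a g)) 0 + dif y (dif x (dif b g)) 0"
      by (metis dif_commute)
    finally show ?thesis
      by (simp add: cubic_form_def algebra_simps sum.distrib)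
  qed
  show "cubic_form N g x y z = cubic_form N g y x z" for x y z
    by (simp add: cubic_form_def dif_commute[of x y] mult_ac)
  show "cubic_form N g x y z = cubic_form N g x z y" for x y z
    by (simp add: cubic_form_def dif_commute[of y z] mult_ac)
qed

text \<open>Differentiating twice in the same direction gives 0 in characteristic 2, so the
  contribution of g disappears whatever g is.\<close>

lemma cubic_form_diag: "cubic_form N g a x x = (\<Sum>i<N. a i * x i)"
proof -
  have "a i * x i * x i = a i * x i" for i
    by (cases "x i") simp_all
  then show ?thesis by (simp only: cubic_form_def dif_self add_0_right)
qed

lemma cubic_form_nondegenerate:
  assumes a: "a \<in> cube N" and 0: "\<And>x. x \<in> cube N \<Longrightarrow> cubic_form N g a x x = 0"
  shows "a = 0"
proof
  fix i
  show "a i = 0 i"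
  proof (cases "i < N")
    case True
    define x :: "nat \<Rightarrow> bit" where "x j = (if j = i then 1 else 0)" for j
    have "x \<in> cube N" using True by (auto simp: x_def cube_def)
    then show ?thesis
      using 0[of x] True by (simp add: cubic_form_diag x_def if_distrib cong: if_cong)
  qed (use a in \<open>auto simp: cube_def\<close>)
qed

section \<open>Multiplicative derivatives of the phase\<close>

definition mdif :: "'a::ab_group_add \<Rightarrow> ('a \<Rightarrow> complex) \<Rightarrow> 'a \<Rightarrow> complex" where
  "mdif a f x = f (x + a) * cnj (f x)"

lemma sum_mdif:
  assumes G: "add_subgroup G"
  shows "(\<Sum>a\<in>G. \<Sum>x\<in>G. mdif a f x) = complex_of_real ((norm (\<Sum>x\<in>G. f x))\<^sup>2)"
proof -
  have "(\<Sum>a\<in>G. \<Sum>x\<in>G. mdif a f x) = (\<Sum>x\<in>G. (\<Sum>a\<in>G. f (a + x)) * cnj (f x))"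
    by (subst sum.swap) (simp add: mdif_def sum_distrib_right add.commute)
  also have "\<dots> = (\<Sum>x\<in>G. (\<Sum>a\<in>G. f a) * cnj (f x))"
    by (intro sum.cong refl) (simp add: sum_add_subgroup_shift[OF G])
  also have "\<dots> = (\<Sum>x\<in>G. f x) * cnj (\<Sum>x\<in>G. f x)"
    by (simp add: sum_distrib_left)
  finally show ?thesis by (simp only: complex_norm_square)
qed

lemma norm_sum_squared_le:
  assumes "add_subgroup G"
  shows "(norm (\<Sum>x\<in>G. f x))\<^sup>2 \<le> (\<Sum>a\<in>G. norm (\<Sum>x\<in>G. mdif a f x))"
proof -
  have "(norm (\<Sum>x\<in>G. f x))\<^sup>2 = norm (\<Sum>a\<in>G. \<Sum>x\<in>G. mdif a f x)"
    by (simp only: sum_mdif[OF assms] norm_of_real abs_power2)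
  also have "\<dots> \<le> (\<Sum>a\<in>G. norm (\<Sum>x\<in>G. mdif a f x))"
    by (rule norm_sum)
  finally show ?thesis .
qed

text \<open>The factor |G|^5 collects |G|^2 from Cauchy-Schwarz over a, squared afterwards, |G|^2
  from Cauchy-Schwarz over pairs (a, b), and |G| from the constancy of the third derivative in
  x.\<close>

lemma gowers_norm_bound:
  assumes G: "add_subgroup G"
    and \<tau>: "\<And>a b c x. \<lbrakk>a \<in> G; b \<in> G; c \<in> G; x \<in> G\<rbrakk> \<Longrightarrow> mdif c (mdif b (mdif a f)) x = complex_of_real (\<chi> (\<tau> a b c))"
  shows "norm (\<Sum>x\<in>G. f x) ^ 8 \<le> real (card G) ^ 5 * (\<Sum>a\<in>G. \<Sum>b\<in>G. \<Sum>c\<in>G. \<chi> (\<tau> a b c))"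
proof -
  define M where "M = real (card G)"
  define P where "P = norm (\<Sum>x\<in>G. f x)"
  define r where "r a = norm (\<Sum>x\<in>G. mdif a f x)" for a
  define s where "s a b = norm (\<Sum>x\<in>G. mdif b (mdif a f) x)" for a b
  have P2: "P\<^sup>2 \<le> (\<Sum>a\<in>G. r a)"
    unfolding P_def r_def by (rule norm_sum_squared_le[OF G])
  have r2: "(r a)\<^sup>2 \<le> (\<Sum>b\<in>G. s a b)" for a
    unfolding r_def s_def by (rule norm_sum_squared_le[OF G])
  \<comment> \<open>The last differencing is kept as an identity, so the signs
    \<open>\<chi> (\<tau> a b c)\<close> survive without absolute values.\<close>
  have s2: "(s a b)\<^sup>2 = M * (\<Sum>c\<in>G. \<chi> (\<tau> a b c))" if "a \<in> G" "b \<in> G" for a b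
  proof -
    have "complex_of_real ((s a b)\<^sup>2) = (\<Sum>c\<in>G. \<Sum>x\<in>G. mdif c (mdif b (mdif a f)) x)"
      unfolding s_def by (rule sum_mdif[OF G, symmetric])
    also have "\<dots> = (\<Sum>c\<in>G. \<Sum>x\<in>G. complex_of_real (\<chi> (\<tau> a b c)))"
      using that by (intro sum.cong refl) (simp add: \<tau>)
    also have "\<dots> = complex_of_real (M * (\<Sum>c\<in>G. \<chi> (\<tau> a b c)))"
      by (simp add: M_def sum_distrib_left)
    finally show ?thesis using of_real_eq_iff by blast
  qed
  have "P ^ 4 = (P\<^sup>2)\<^sup>2" by simp
  also have "\<dots> \<le> (\<Sum>a\<in>G. r a)\<^sup>2" using P2 by (intro power_mono) auto
  also have "\<dots> \<le> M * (\<Sum>a\<in>G. (r a)\<^sup>2)" 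
    unfolding M_def using sum_squared_le_sum_of_squares[of r G] by (simp add: mult.commute)
  also have "\<dots> \<le> M * (\<Sum>a\<in>G. \<Sum>b\<in>G. s a b)"
    using r2 by (intro mult_left_mono sum_mono) (auto simp: M_def)
  finally have P4: "P ^ 4 \<le> M * (\<Sum>p\<in>G \<times> G. s (fst p) (snd p))"
    by (simp add: sum.cartesian_product case_prod_beta)
  have "P ^ 8 = (P ^ 4)\<^sup>2" by simp
  also have "\<dots> \<le> (M * (\<Sum>p\<in>G \<times> G. s (fst p) (snd p)))\<^sup>2"
    using P4 by (intro power_mono) (auto simp: P_def)
  also have "\<dots> = M\<^sup>2 * (\<Sum>p\<in>G \<times> G. s (fst p) (snd p))\<^sup>2"
    by (simp add: power_mult_distrib)
  also have "\<dots> \<le> M\<^sup>2 * (real (card (G \<times> G)) * (\<Sum>p\<in>G \<times> G. (s (fst p) (snd p))\<^sup>2))"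
    using sum_squared_le_sum_of_squares[of "\<lambda>p. s (fst p) (snd p)" "G \<times> G"]
    by (intro mult_left_mono) (simp_all add: mult.commute)
  also have "(\<Sum>p\<in>G \<times> G. (s (fst p) (snd p))\<^sup>2) = (\<Sum>a\<in>G. \<Sum>b\<in>G. (s a b)\<^sup>2)"
    by (simp add: sum.cartesian_product case_prod_beta)
  also have "\<dots> = (\<Sum>a\<in>G. \<Sum>b\<in>G. M * (\<Sum>c\<in>G. \<chi> (\<tau> a b c)))"
    by (intro sum.cong refl s2)
  also have "\<dots> = M * (\<Sum>a\<in>G. \<Sum>b\<in>G. \<Sum>c\<in>G. \<chi> (\<tau> a b c))"
    by (simp add: sum_distrib_left)
  finally show ?thesis
    by (simp add: P_def M_def card_cartesian_product eval_nat_numeral mult_ac)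
qed

section \<open>The weight phase and its third derivative\<close>

definition weight :: "nat \<Rightarrow> (nat \<Rightarrow> bit) \<Rightarrow> nat" where
  "weight N x = card {i \<in> {..<N}. x i = 1}"

lemma mdif_mult: "mdif a (\<lambda>x. f x * g x) = (\<lambda>x. mdif a f x * mdif a g x)"
  by (simp add: mdif_def fun_eq_iff mult_ac)

lemma mdif_prod: "mdif a (\<lambda>x. \<Prod>i\<in>I. f i x) = (\<lambda>x. \<Prod>i\<in>I. mdif a (f i) x)"
  by (simp add: mdif_def fun_eq_iff prod.distrib)

lemma mdif_\<chi>: "mdif a (\<lambda>x. complex_of_real (\<chi> (g x))) = (\<lambda>x. complex_of_real (\<chi> (dif a g x)))"
  by (simp add: mdif_def dif_def \<chi>_add fun_eq_iff)

lemma \<chi>_sum: "\<chi> (\<Sum>i\<in>I. f i) = (\<Prod>i\<in>I. \<chi> (f i))"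
  by (induction I rule: infinite_finite_induct) (simp_all add: \<chi>_add)

lemma power_weight: "\<zeta> ^ weight N x = (\<Prod>i<N. if x i = 1 then \<zeta> else 1)" for \<zeta> :: complex
  by (simp add: weight_def prod.If_cases Int_def)

text \<open>If a direction fixes coordinate i, its derivative of a unimodular function of that
  coordinate is 1. If all three flip it, the successive derivatives are powers of \<zeta> with
  exponents \<plusminus>1, \<plusminus>2, \<plusminus>4, ending at -1.\<close>

lemma mdif3_coordinate:
  assumes \<zeta>: "\<zeta> ^ 4 = -1"
  shows "mdif c (mdif b (mdif a (\<lambda>x. if x i = (1::bit) then \<zeta> else 1))) x
    = complex_of_real (\<chi> (a i * b i * c i))"
proof -
  have "norm \<zeta> ^ 4 = 1" using \<zeta> by (metis norm_minus_cancel norm_one norm_power)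
  then have "norm \<zeta> = 1" using power_eq_imp_eq_base[of "norm \<zeta>" 4 1] by simp
  then have "\<zeta> * cnj \<zeta> = 1" by (simp add: complex_norm_square[symmetric])
  have 1: "\<zeta> * (cnj \<zeta> * w) = w" for w using \<open>\<zeta> * cnj \<zeta> = 1\<close> by (simp flip: mult.assoc)
  have 2: "\<zeta> * (\<zeta> * (\<zeta> * \<zeta>)) = -1" using \<zeta> by (simp add: eval_nat_numeral)
  have 3: "cnj \<zeta> * (cnj \<zeta> * (cnj \<zeta> * cnj \<zeta>)) = -1" using arg_cong[OF 2, of cnj] by simp
  show ?thesis
    unfolding mdif_def plus_fun_apply
    by (cases "x i"; cases "a i"; cases "b i"; cases "c i")
      (simp_all add: 1 2 3 \<chi>_def \<open>\<zeta> * cnj \<zeta> = 1\<close> mult_ac)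
qed

lemma mdif3_phase:
  assumes \<zeta>: "\<zeta> ^ 4 = -1" and g: "deg_less 4 g"
  shows "mdif c (mdif b (mdif a (\<lambda>x. \<zeta> ^ weight N x * complex_of_real (\<chi> (g x))))) x
    = complex_of_real (\<chi> (cubic_form N g a b c))"
  unfolding power_weight mdif_mult mdif_prod mdif_\<chi> mdif3_coordinate[OF \<zeta>] dif3_const[OF g, of c b a x]
  by (simp add: cubic_form_def \<chi>_add \<chi>_sum)

text \<open>The exponent is 40 = 8 * 5: the three differencings give p^8 \<le> \<mu>, and the bias
  bound gives (\<mu>/4)^5 2^N \<le> 1.\<close>

lemma phase_sum_bound:
  fixes N :: nat
  assumes \<zeta>: "\<zeta> ^ 4 = -1" and g: "deg_less 4 g"
  defines "p \<equiv> norm (\<Sum>x\<in>cube N. \<zeta> ^ weight N x * complex_of_real (\<chi> (g x))) / 2 ^ N"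
  shows "p ^ 40 * 2 ^ N \<le> 4 ^ 5"
proof -
  interpret symmetric_trilinear "cube N" "cubic_form N g"
    by (rule symmetric_trilinear_cubic_form[OF g])
  define M :: real where "M = 2 ^ N"
  have M: "M > 0" by (simp add: M_def)
  define \<mu> where "\<mu> = (\<Sum>a\<in>cube N. \<Sum>b\<in>cube N. \<Sum>c\<in>cube N. \<chi> (cubic_form N g a b c)) / M ^ 3"
  have "(\<mu> / 4) ^ 5 * card (cube N) \<le> 1"
  proof (rule sum_\<chi>_bound)
    show "(\<Sum>a\<in>cube N. \<Sum>b\<in>cube N. \<Sum>c\<in>cube N. \<chi> (cubic_form N g a b c)) = \<mu> * real (card (cube N)) ^ 3"
      by (simp add: \<mu>_def card_cube M_def)
  qed (rule cubic_form_nondegenerate)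
  then have \<mu>: "(\<mu> / 4) ^ 5 * M \<le> 1" by (simp add: card_cube M_def)
  have "(p * M) ^ 8 \<le> M ^ 5 * (\<mu> * M ^ 3)"
    using gowers_norm_bound[OF add_subgroup_cube mdif3_phase[OF \<zeta> g], of N N] M
    by (simp add: p_def \<mu>_def card_cube M_def)
  also have "\<dots> = \<mu> * M ^ 8" by (simp add: power_add[symmetric])
  finally have "p ^ 8 \<le> \<mu>" using M by (simp add: power_mult_distrib)
  then have "(p ^ 8) ^ 5 \<le> \<mu> ^ 5" by (intro power_mono) (simp_all add: p_def)
  then have "p ^ 40 * M \<le> \<mu> ^ 5 * M" using M by (simp flip: power_mult)
  also have "\<dots> \<le> 4 ^ 5" using \<mu> by (simp add: power_divide)
  finally show ?thesis by (simp add: M_def)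
qed

section \<open>Fourier expansion of the sign of S4\<close>

lemma S_eq_choose: "S N k x = of_nat (weight N x choose k)"
proof -
  define A where "A = {i \<in> {..<N}. x i = 1}"
  \<comment> \<open>A monomial is 1 exactly when its variables all lie in the support A of x, so S
    counts the k-subsets of A modulo 2.\<close>
  have "(\<Prod>i\<in>T. x i) = (if T \<subseteq> A then 1 else 0)" if "T \<subseteq> {..<N}" for T
  proof (cases "T \<subseteq> A")
    case True
    then show ?thesis by (auto simp: A_def intro!: prod.neutral)
  next
    case False
    then obtain i where "i \<in> T" "i \<notin> A" by blast
    then have "i \<in> T" "x i = 0" using that by (auto simp: A_def)
    moreover have "finite T" using that finite_subset by blast
    ultimately show ?thesis using False by auto
  qed
  then have "S N k x = (\<Sum>T\<in>{T. T \<subseteq> {..<N} \<and> card T = k}. if T \<subseteq> A then 1 else 0)"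
    unfolding S_def by (intro sum.cong) auto
  also have "\<dots> = (\<Sum>T\<in>{T. T \<subseteq> A \<and> card T = k}. 1)"
    by (rule sum.mono_neutral_cong_right) (auto simp: A_def)
  also have "\<dots> = of_nat (card A choose k)"
    using n_subsets[of A k] by (simp add: A_def)
  finally show ?thesis by (simp add: A_def weight_def)
qed

lemma \<chi>_of_nat: "\<chi> (of_nat n) = (-1) ^ n"
  by (induction n) (simp_all add: \<chi>_add, simp add: \<chi>_def)

text \<open>These are exp(i pi/4) and exp(3 i pi/4). The other primitive eighth roots of unity are
  their conjugates, so real and imaginary parts of these two suffice for a real expansion.\<close>

abbreviation \<zeta>\<^sub>1 :: complex where "\<zeta>\<^sub>1 \<equiv> Complex (sqrt 2 / 2) (sqrt 2 / 2)"
abbreviation \<zeta>\<^sub>3 :: complex where "\<zeta>\<^sub>3 \<equiv> Complex (- sqrt 2 / 2) (sqrt 2 / 2)"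

lemma \<zeta>_power4: "\<zeta>\<^sub>1 ^ 4 = -1" "\<zeta>\<^sub>3 ^ 4 = -1"
  by (simp_all add: eval_nat_numeral complex_eq_iff field_simps)

text \<open>Fourier expansion on the integers modulo 8: the fourth binomial coefficient changes parity
  under a shift by 4, so only odd frequencies occur.\<close>
lemma choose4_fourier:
  "(-1) ^ (w choose 4) = (Re (\<zeta>\<^sub>1 ^ w) + Re (\<zeta>\<^sub>3 ^ w)) / 2
     + (sqrt 2 + 1) / 2 * Im (\<zeta>\<^sub>1 ^ w) + (sqrt 2 - 1) / 2 * Im (\<zeta>\<^sub>3 ^ w)"
proof (induction w rule: less_induct)
  case (less w)
  show ?case
  proof (cases "w < 4")
    case True
    then consider "w = 0" | "w = 1" | "w = 2" | "w = 3" by linarith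
    then show ?thesis
      by cases (simp_all add: eval_nat_numeral field_simps)
  next
    case False
    then obtain v where v: "w = v + 4" by (metis add.commute le_Suc_ex not_less)
    \<comment> \<open>Vandermonde's identity; modulo 2 only the first and last terms remain.\<close>
    have "(v + 4 choose 4) = (v choose 4) + 4 * (v choose 3) + 6 * (v choose 2) + 4 * v + 1"
      by (simp add: eval_nat_numeral)
    then have "odd ((v + 4 choose 4) + (v choose 4))" by simp
    then have "(-1::real) ^ (w choose 4) = - ((-1) ^ (v choose 4))"
      unfolding v by (cases "even (v choose 4)") auto
    moreover have "\<zeta>\<^sub>1 ^ w = - (\<zeta>\<^sub>1 ^ v)" "\<zeta>\<^sub>3 ^ w = - (\<zeta>\<^sub>3 ^ v)"
      unfolding v power_add \<zeta>_power4 by simp_all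
    ultimately show ?thesis
      using less.IH[of v] v by (simp add: field_simps)
  qed
qed

lemma corr_S4_bound:
  assumes g: "deg_less 4 g"
  shows "\<exists>p. p \<ge> 0 \<and> p ^ 40 * 2 ^ N \<le> 4 ^ 5 \<and> \<bar>corr N (S N 4) g\<bar> \<le> 3 * p"
proof -
  define P where "P \<zeta> = (\<Sum>x\<in>cube N. \<zeta> ^ weight N x * complex_of_real (\<chi> (g x)))" for \<zeta>
  have Re: "Re (P \<zeta>) = (\<Sum>x\<in>cube N. Re (\<zeta> ^ weight N x) * \<chi> (g x))"
    and Im: "Im (P \<zeta>) = (\<Sum>x\<in>cube N. Im (\<zeta> ^ weight N x) * \<chi> (g x))" for \<zeta>
    by (simp_all add: P_def)
  define p where "p = max (norm (P \<zeta>\<^sub>1) / 2 ^ N) (norm (P \<zeta>\<^sub>3) / 2 ^ N)"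
  have p: "norm (P \<zeta>\<^sub>1) \<le> p * 2 ^ N" "norm (P \<zeta>\<^sub>3) \<le> p * 2 ^ N"
    by (auto simp: p_def pos_divide_le_eq[symmetric])
  have "(norm (P \<zeta>\<^sub>1) / 2 ^ N) ^ 40 * 2 ^ N \<le> 4 ^ 5" "(norm (P \<zeta>\<^sub>3) / 2 ^ N) ^ 40 * 2 ^ N \<le> 4 ^ 5"
    unfolding P_def by (rule phase_sum_bound[OF \<zeta>_power4(1) g], rule phase_sum_bound[OF \<zeta>_power4(2) g])
  then have "p ^ 40 * 2 ^ N \<le> 4 ^ 5"
    unfolding p_def max_def by (simp only: split: if_split) blast
  moreover have "p \<ge> 0" by (simp add: p_def le_max_iff_disj)
  moreover have "\<bar>corr N (S N 4) g\<bar> \<le> 3 * p"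
  proof -
    have "\<chi> (S N 4 x - g x) = (-1) ^ (weight N x choose 4) * \<chi> (g x)" for x
      by (simp add: S_eq_choose \<chi>_add \<chi>_of_nat)
    then have "corr N (S N 4) g * 2 ^ N = (\<Sum>x\<in>cube N. (-1) ^ (weight N x choose 4) * \<chi> (g x))"
      unfolding corr_def \<chi>_def[symmetric] by simp
    also have "\<dots> = (Re (P \<zeta>\<^sub>1) + Re (P \<zeta>\<^sub>3)) / 2
        + (sqrt 2 + 1) / 2 * Im (P \<zeta>\<^sub>1) + (sqrt 2 - 1) / 2 * Im (P \<zeta>\<^sub>3)"
      unfolding Re Im choose4_fourier
      by (simp add: sum.distrib[symmetric] sum_distrib_left sum_divide_distrib algebra_simps
          add_divide_distrib diff_divide_distrib sum_subtractf[symmetric])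
    finally have eq: "corr N (S N 4) g * 2 ^ N = (Re (P \<zeta>\<^sub>1) + Re (P \<zeta>\<^sub>3)) / 2
        + (sqrt 2 + 1) / 2 * Im (P \<zeta>\<^sub>1) + (sqrt 2 - 1) / 2 * Im (P \<zeta>\<^sub>3)" .
    \<comment> \<open>The crude bound sqrt 2 \<le> 2 yields the coefficients 3/2 and 1/2 below; with
      total weight 1 on the real parts they add up to 3.\<close>
    have sqrt2: "1 \<le> sqrt 2" "sqrt 2 \<le> 2" by (auto intro: real_le_lsqrt)
    define u v where "u = (sqrt 2 + 1) / 2 * Im (P \<zeta>\<^sub>1)" and "v = (sqrt 2 - 1) / 2 * Im (P \<zeta>\<^sub>3)"
    have "\<bar>u\<bar> \<le> 3 / 2 * (p * 2 ^ N)"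
      using sqrt2 p abs_Im_le_cmod[of "P \<zeta>\<^sub>1"] unfolding u_def v_def abs_mult by (intro mult_mono) auto
    moreover have "\<bar>v\<bar> \<le> 1 / 2 * (p * 2 ^ N)"
      using sqrt2 p abs_Im_le_cmod[of "P \<zeta>\<^sub>3"] unfolding u_def v_def abs_mult by (intro mult_mono) auto
    moreover have "\<bar>Re (P \<zeta>\<^sub>1)\<bar> \<le> p * 2 ^ N" "\<bar>Re (P \<zeta>\<^sub>3)\<bar> \<le> p * 2 ^ N"
      using p abs_Re_le_cmod order.trans by blast+
    ultimately have "\<bar>corr N (S N 4) g * 2 ^ N\<bar> \<le> 3 * (p * 2 ^ N)"
      unfolding eq u_def[symmetric] v_def[symmetric] by argo
    then show ?thesis by (simp add: abs_mult)
  qed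
  ultimately show ?thesis by blast
qed

section \<open>Absorbing the constants into the exponential rate\<close>

theorem theorem1p3:
  shows "\<exists>\<alpha>::real. \<alpha> > 0 \<and> (\<exists>N0::nat. \<forall>N\<ge>N0. \<forall>c :: nat set \<Rightarrow> bit.
           \<bar>corr N (S N 4) (poly_fun N 3 c)\<bar> < exp (- \<alpha> * real N))"
proof (intro exI[of _ "ln 2 / 80"] conjI)
  \<comment> \<open>The bound on p decays like 2^(-N/40). The rate ln 2 / 80 keeps half of that
    exponent; the other half beats the constant 4^5 * 3^40 once 2^(N/2) exceeds it.\<close>
  obtain N0 where N0: "(4 ^ 5 * 3 ^ 40)\<^sup>2 < (2::real) ^ N0"
    using real_arch_pow[of 2] by auto
  show "\<exists>N0::nat. \<forall>N\<ge>N0. \<forall>c. \<bar>corr N (S N 4) (poly_fun N 3 c)\<bar> < exp (- (ln 2 / 80) * real N)"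
  proof (intro exI[of _ N0] allI impI)
    fix N c assume N: "N0 \<le> N"
    define E where "E = exp (- (ln 2 / 80) * real N)"
    have "deg_less 4 (poly_fun N 3 c)"
      using deg_less_poly_fun[of 3] by (simp add: eval_nat_numeral)
    then obtain p where p: "p \<ge> 0" "p ^ 40 * 2 ^ N \<le> 4 ^ 5" "\<bar>corr N (S N 4) (poly_fun N 3 c)\<bar> \<le> 3 * p"
      using corr_S4_bound by blast
    have "3 * p < E"
    proof (rule ccontr)
      assume "\<not> 3 * p < E"
      then have "E ^ 40 \<le> (3 * p) ^ 40" by (intro power_mono) (auto simp: E_def)
      then have "E ^ 40 * 2 ^ N \<le> 3 ^ 40 * (p ^ 40 * 2 ^ N)" by (simp add: power_mult_distrib)
      also have "\<dots> \<le> 3 ^ 40 * 4 ^ 5" using p(2) by (intro mult_left_mono) auto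
      \<comment> \<open>E is 2^(-N/80), so E^40 * 2^N is 2^(N/2); squaring avoids the fractional
        exponent.\<close>
      finally have "(E ^ 40 * 2 ^ N)\<^sup>2 \<le> (4 ^ 5 * 3 ^ 40)\<^sup>2"
        by (intro power_mono) (auto simp: E_def)
      moreover have "E ^ 80 = 1 / 2 ^ N"
      proof -
        have "E ^ 80 = exp (- (real N * ln 2))"
          unfolding E_def by (simp flip: exp_of_nat_mult)
        then show ?thesis by (simp add: exp_minus exp_of_nat_mult divide_inverse)
      qed
      then have "(E ^ 40 * 2 ^ N)\<^sup>2 = 2 ^ N"
        by (simp add: power_mult_distrib flip: power_mult) (simp add: power2_eq_square mult_2_right power_add)
      moreover have "(2::real) ^ N0 \<le> 2 ^ N" using N by (intro power_increasing) auto
      ultimately show False using N0 by linarith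
    qed
    with p(3) show "\<bar>corr N (S N 4) (poly_fun N 3 c)\<bar> < exp (- (ln 2 / 80) * real N)"
      by (simp add: E_def)
  qed
qed simp

end
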